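(* Let $\mathfrak g$ be a nonzero complete left-symmetric algebra over $\mathbb C$ whose canonical decomposition $\mathfrak g=\bigoplus_\lambda\mathfrak g^\lambda$ satisfies $\dim\mathfrak g^\lambda\le 1$ for all $\lambda$. If the graph $\Gamma_l$ contains an edge from $\lambda$ to $0$, then $-\lambda$ is a vertex of $\Gamma_l$ and $\Gamma_l$ contains an edge from $-\lambda$ to $0$.
   Context: All algebras are finite dimensional. A left-symmetric algebra is a vector space $\mathfrak g$ with a bilinear product such that $x(yz)-(xy)z=y(xz)-(yx)z$ for all $x,y,z$. Then $[x,y]=xy-yx$ is a Lie bracket and $L(x)y=xy$ defines a representation of the Lie algebra $\mathfrak g$. The fields $F_x(y)=xy+x$, $x\in\mathfrak g$, form a Lie algebra of affine vector fields on the space $\mathfrak g$; $\mathfrak g$ is complete if the group of affine transformations generated by their flows acts transitively on $\mathfrak g$. Canonical decomposition: a complete left-symmetric algebra over $\mathbb C$ has a unique Cartan subalgebra $\mathfrak h$ of the Lie algebra $\mathfrak g$ such that, for every linear functional $\lambda$ on $\mathfrak h$, the root subspace (generalized weight space) $\mathfrak g^\lambda$ of $\lambda$ for $L|_{\mathfrak h}$ equals the root subspace for $\operatorname{ad}|_{\mathfrak h}$; the canonical decomposition is $\mathfrak g=\bigoplus_\lambda\mathfrak g^\lambda$, and $\mathfrak g^0=\mathfrak h$. It satisfies $\mathfrak g^\lambda\mathfrak g^\mu\subseteq\mathfrak g^{\lambda+\mu}$. Graphs: assume $\dim\mathfrak g^\lambda\le1$ for all $\lambda$. Fix $e_0\in\mathfrak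 g^0$, $e_0\neq0$. Identify each functional $\lambda$ with $\mathfrak g^\lambda\ne0$ with the number $\lambda(e_0)$; the set of these numbers is $\Lambda\subset\mathbb C$, the spectrum of $L(e_0)$ (it contains $0$). For each $\lambda\in\Lambda$ choose an eigenvector $e_\lambda\in\mathfrak g^\lambda$, $e_0e_\lambda=\lambda e_\lambda$ (with the chosen $e_0$ for $\lambda=0$). In the base $\{e_\lambda\}_{\lambda\in\Lambda}$ the product is $e_\lambda e_\mu=c_{\lambda,\mu}e_{\lambda+\mu}$, with the convention $e_\lambda=0$ and $c_{\lambda,\mu}=c_{\mu,\lambda}=0$ if $\lambda\notin\Lambda$. $\Gamma_l$ is the directed graph (loops allowed) with vertex set $\Lambda$ having an edge from $\lambda$ to $\mu$ if and only if $c_{\mu-\lambda,\lambda}\neq0$. *)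

theory Defs
  imports
    Complex_Main
    "HOL-Algebra.Bij"
    "HOL-Algebra.Generated_Groups"
    "Graph_Theory.Pair_Digraph"
begin

locale left_symmetric_algebra = vector_space scale
  for scale :: "'k::field \<Rightarrow> 'a::ab_group_add \<Rightarrow> 'a" +
  fixes mul :: "'a \<Rightarrow> 'a \<Rightarrow> 'a"
  assumes finite_dim: "\<exists>B. finite B \<and> span B = UNIV"
    and linear_left: "Vector_Spaces.linear scale scale (mul x)"
    and linear_right: "Vector_Spaces.linear scale scale (\<lambda>x. mul x y)"
    and left_symmetric: "mul x (mul y z) - mul (mul x y) z = mul y (mul x z) - mul (mul y x) z"

definition lie_bracket :: "('a::ab_group_add \<Rightarrow> 'a \<Rightarrow> 'a) \<Rightarrow> 'a \<Rightarrow> 'a \<Rightarrow> 'a" where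
  "lie_bracket mul x y = mul x y - mul y x"

text \<open>
  The derivative of a curve in a finite-dimensional complex vector space is taken in its
  canonical topology. To avoid choosing a norm or a basis it is tested against all complex linear
  functionals, which in finite dimension is the same thing.
\<close>

definition integral_curve ::
    "(complex \<Rightarrow> 'a::ab_group_add \<Rightarrow> 'a) \<Rightarrow> ('a \<Rightarrow> 'a) \<Rightarrow> (real \<Rightarrow> 'a) \<Rightarrow> bool" where
  "integral_curve scale F \<gamma> \<longleftrightarrow>
     (\<forall>f. Vector_Spaces.linear scale (*) f \<longrightarrow>
        (\<forall>t. ((\<lambda>s. f (\<gamma> s)) has_vector_derivative f (F (\<gamma> t))) (at t)))"

definition flow ::
    "(complex \<Rightarrow> 'a::ab_group_add \<Rightarrow> 'a) \<Rightarrow> ('a \<Rightarrow> 'a) \<Rightarrow> real \<Rightarrow> 'a \<Rightarrow> 'a" where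
  "flow scale F t p = (THE q. \<exists>\<gamma>. integral_curve scale F \<gamma> \<and> \<gamma> 0 = p \<and> \<gamma> t = q)"

definition affine_field :: "('a::ab_group_add \<Rightarrow> 'a \<Rightarrow> 'a) \<Rightarrow> 'a \<Rightarrow> 'a \<Rightarrow> 'a" where
  "affine_field mul x y = mul x y + x"

text \<open>
  Real flow times suffice: the flow of the field of \<open>x\<close> at complex time \<open>c\<close> is the flow of the
  field of \<open>c x\<close> at time 1.
\<close>

definition complete_lsa ::
    "(complex \<Rightarrow> 'a::ab_group_add \<Rightarrow> 'a) \<Rightarrow> ('a \<Rightarrow> 'a \<Rightarrow> 'a) \<Rightarrow> bool" where
  "complete_lsa scale mul \<longleftrightarrow>
     (\<forall>p q. \<exists>T \<in> generate (BijGroup UNIV) {flow scale (affine_field mul x) t | x t. True}. T p = q)"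

primrec lower_central ::
    "('k::field \<Rightarrow> 'a::ab_group_add \<Rightarrow> 'a) \<Rightarrow> ('a \<Rightarrow> 'a \<Rightarrow> 'a) \<Rightarrow> 'a set \<Rightarrow> nat \<Rightarrow> 'a set" where
  "lower_central scale br h 0 = h"
| "lower_central scale br h (Suc n) =
     module.span scale {br x y | x y. x \<in> h \<and> y \<in> lower_central scale br h n}"

text \<open>A Cartan subalgebra is a nilpotent self-normalizing Lie subalgebra.\<close>

definition cartan_subalgebra ::
    "('k::field \<Rightarrow> 'a::ab_group_add \<Rightarrow> 'a) \<Rightarrow> ('a \<Rightarrow> 'a \<Rightarrow> 'a) \<Rightarrow> 'a set \<Rightarrow> bool" where
  "cartan_subalgebra scale br h \<longleftrightarrow>
     module.subspace scale h \<and> (\<forall>x\<in>h. \<forall>y\<in>h. br x y \<in> h) \<and>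
     (\<exists>n. lower_central scale br h n = {0}) \<and>
     {x. \<forall>y\<in>h. br x y \<in> h} = h"

text \<open>
  Functionals on \<open>h\<close> are functions on the whole type of which only the values on \<open>h\<close> are
  constrained and used.
\<close>

definition linear_functional_on ::
    "('k::field \<Rightarrow> 'a::ab_group_add \<Rightarrow> 'a) \<Rightarrow> 'a set \<Rightarrow> ('a \<Rightarrow> 'k) \<Rightarrow> bool" where
  "linear_functional_on scale h \<phi> \<longleftrightarrow>
     (\<forall>x\<in>h. \<forall>y\<in>h. \<phi> (x + y) = \<phi> x + \<phi> y) \<and> (\<forall>c. \<forall>x\<in>h. \<phi> (scale c x) = c * \<phi> x)"

definition root_subspace ::
    "('k::field \<Rightarrow> 'a::ab_group_add \<Rightarrow> 'a) \<Rightarrow> ('a \<Rightarrow> 'a \<Rightarrow> 'a) \<Rightarrow> 'a set \<Rightarrow> ('a \<Rightarrow> 'k) \<Rightarrow> 'a set" where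
  "root_subspace scale \<rho> h \<phi> = {v. \<forall>x\<in>h. \<exists>n. ((\<lambda>w. \<rho> x w - scale (\<phi> x) w) ^^ n) v = 0}"

text \<open>
  The left multiplication representation is \<open>mul\<close> itself, the adjoint one is \<open>lie_bracket mul\<close>.
\<close>

definition canonical_cartan ::
    "('k::field \<Rightarrow> 'a::ab_group_add \<Rightarrow> 'a) \<Rightarrow> ('a \<Rightarrow> 'a \<Rightarrow> 'a) \<Rightarrow> 'a set \<Rightarrow> bool" where
  "canonical_cartan scale mul h \<longleftrightarrow>
     cartan_subalgebra scale (lie_bracket mul) h \<and>
     (\<forall>\<phi>. linear_functional_on scale h \<phi> \<longrightarrow>
        root_subspace scale mul h \<phi> = root_subspace scale (lie_bracket mul) h \<phi>)"

definition spectrum ::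
    "('k::field \<Rightarrow> 'a::ab_group_add \<Rightarrow> 'a) \<Rightarrow> ('a \<Rightarrow> 'a \<Rightarrow> 'a) \<Rightarrow> 'a set \<Rightarrow> 'a \<Rightarrow> 'k set" where
  "spectrum scale mul h e0 =
     {\<phi> e0 | \<phi>. linear_functional_on scale h \<phi> \<and> root_subspace scale mul h \<phi> \<noteq> {0}}"

definition root_base ::
    "('k::field \<Rightarrow> 'a::ab_group_add \<Rightarrow> 'a) \<Rightarrow> ('a \<Rightarrow> 'a \<Rightarrow> 'a) \<Rightarrow> 'a set \<Rightarrow> 'a \<Rightarrow> ('k \<Rightarrow> 'a) \<Rightarrow> bool" where
  "root_base scale mul h e0 e \<longleftrightarrow>
     e 0 = e0 \<and>
     (\<forall>\<phi>. linear_functional_on scale h \<phi> \<and> root_subspace scale mul h \<phi> \<noteq> {0} \<longrightarrow>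
        e (\<phi> e0) \<in> root_subspace scale mul h \<phi> \<and> e (\<phi> e0) \<noteq> 0 \<and>
        mul e0 (e (\<phi> e0)) = scale (\<phi> e0) (e (\<phi> e0))) \<and>
     (\<forall>l. l \<notin> spectrum scale mul h e0 \<longrightarrow> e l = 0)"

text \<open>
  The coefficient at \<open>e (l + m)\<close> of \<open>mul (e l) (e m)\<close> in the base indexed by \<open>S\<close>. It is 0 unless
  \<open>l\<close>, \<open>m\<close> and \<open>l + m\<close> all lie in \<open>S\<close>, provided that \<open>e\<close> vanishes outside \<open>S\<close>.
\<close>

definition structure_const ::
    "('k::field \<Rightarrow> 'a::ab_group_add \<Rightarrow> 'a) \<Rightarrow> ('a \<Rightarrow> 'a \<Rightarrow> 'a) \<Rightarrow> 'k set \<Rightarrow> ('k \<Rightarrow> 'a) \<Rightarrow> 'k \<Rightarrow> 'k \<Rightarrow> 'k" where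
  "structure_const scale mul S e l m =
     module.representation scale (e ` S) (mul (e l) (e m)) (e (l + m))"

definition left_graph ::
    "('k::field \<Rightarrow> 'a::ab_group_add \<Rightarrow> 'a) \<Rightarrow> ('a \<Rightarrow> 'a \<Rightarrow> 'a) \<Rightarrow> 'k set \<Rightarrow> ('k \<Rightarrow> 'a) \<Rightarrow> 'k pair_pre_digraph" where
  "left_graph scale mul S e =
     \<lparr> pverts = S,
       parcs = {(l, m). l \<in> S \<and> m \<in> S \<and> structure_const scale mul S e (m - l) l \<noteq> 0} \<rparr>"

end

theory Submission
  imports Defs
begin

text \<open>
  The theorem comes down to one application of the representation theory of \<open>sl(2)\<close>.

  One-dimensionality of the zero root space forces \<open>h\<close> to be the line through \<open>e0\<close>
  (\<open>cartan_eq_line\<close>).  Every root vector \<open>e \<mu>\<close> is then an eigenvector of eigenvalue \<open>\<mu>\<close> for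
  \<open>L(e0)\<close> and, because the root spaces of \<open>L\<close> and of \<open>ad\<close> agree, for \<open>ad e0\<close> as well
  (\<open>root_vector_eigenvector\<close>).  Subtracting gives \<open>e \<mu> * e0 = 0\<close>: every root vector kills \<open>e0\<close>
  from the left.

  Let \<open>a = e (-l)\<close> and \<open>b = e l\<close> with \<open>l \<noteq> 0\<close>.  Both \<open>a b\<close> and \<open>b a\<close> are multiples of \<open>e0\<close>, so
  \<open>[a, b] = c e0\<close>, and \<open>c \<noteq> 0\<close> would make \<open>a, b, e0\<close> span a copy of \<open>sl(2)\<close> represented by left
  multiplications.  Modulo the invariant line through \<open>e0\<close> the vector \<open>b\<close> is annihilated by the
  lowering operator \<open>L(a)\<close>, yet its weight is that of the raising operator \<open>L(b)\<close>; a
  finite-dimensional representation has no such lowest weight vector, as \<open>b\<close>, \<open>b b\<close>, \<open>b (b b)\<close>,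
  and so on, would all be nonzero of distinct weights (\<open>no_positive_lowest_weight\<close>).  Hence
  \<open>c = 0\<close>, that is \<open>a b = b a\<close>, and the two structure constants that decide the edges from \<open>l\<close> and
  from \<open>-l\<close> to \<open>0\<close> are equal.
\<close>

section \<open>Linear algebra\<close>

lemma (in vector_space) eigenvectors_independent:
  assumes lin: "Vector_Spaces.linear scale scale f"
    and "finite E"
    and "\<And>x. x \<in> E \<Longrightarrow> x \<noteq> 0 \<and> f x = k x *s x"
    and "inj_on k E"
  shows "independent E"
  using assms(2-)
proof (induction E rule: finite_induct)
  case empty
  then show ?case by (simp add: independent_empty)
next
  case (insert x E)
  interpret f: Vector_Spaces.linear scale scale f by (rule lin)
  have ind: "independent E"
    using insert by (simp add: inj_on_insert)
  have "x \<notin> span E"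
  proof
    assume "x \<in> span E"
    then obtain u where u: "x = (\<Sum>y\<in>E. u y *s y)"
      using span_finite[OF insert.hyps(1)] by auto
    have "f x = (\<Sum>y\<in>E. (u y * k y) *s y)"
      using insert.prems(1) by (subst u) (simp add: f.sum f.scale cong: sum.cong)
    moreover have "f x = (\<Sum>y\<in>E. (u y * k x) *s y)"
    proof -
      have "f x = k x *s x" using insert.prems(1) by simp
      also have "\<dots> = (\<Sum>y\<in>E. (u y * k x) *s y)"
        by (subst (2) u) (simp add: scale_sum_right mult.commute)
      finally show ?thesis .
    qed
    ultimately have "(\<Sum>y\<in>E. (u y * (k y - k x)) *s y) = 0"
      by (simp add: right_diff_distrib scale_left_diff_distrib sum_subtractf)
    then have z: "u y * (k y - k x) = 0" if "y \<in> E" for y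
      using independentD[OF ind insert.hyps(1) subset_refl,
          where u = "\<lambda>y. u y * (k y - k x)"] that by blast
    have "u y = 0" if "y \<in> E" for y
      using z[OF that] that insert.hyps(2) insert.prems(2) by (auto simp: inj_on_def)
    then have "x = 0" using u by simp
    then show False using insert.prems(1) by simp
  qed
  then show ?case using ind by (rule independent_insertI)
qed

lemma (in vector_space) finite_dim_interpretation:
  assumes "\<exists>B. finite B \<and> span B = UNIV"
  obtains Basis where "finite_dimensional_vector_space scale Basis"
proof -
  obtain B where B: "finite B" "span B = UNIV" using assms by blast
  obtain C where C: "C \<subseteq> B" "independent C" "B \<subseteq> span C"
    using maximal_independent_subset by blast
  have "span C = UNIV" using C(3) B(2) span_minimal[OF C(3) subspace_span] by auto
  then have "finite_dimensional_vector_space scale C"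
    using C B(1) by unfold_locales (auto intro: finite_subset)
  then show thesis using that by blast
qed

lemma (in vector_space) dim_le_1_subset_line:
  assumes "\<exists>B. finite B \<and> span B = UNIV"
    and "dim S \<le> 1" "v \<in> S" "v \<noteq> 0" "w \<in> S"
  shows "\<exists>c. w = c *s v"
proof -
  obtain Basis where "finite_dimensional_vector_space scale Basis"
    using finite_dim_interpretation[OF assms(1)] .
  then interpret finite_dimensional_vector_space scale Basis .
  have "S \<subseteq> span {v}"
    using assms by (intro card_ge_dim_independent) (auto simp: dependent_single)
  then show ?thesis using assms(5) by (auto simp: span_singleton)
qed

text \<open>
  In an \<open>sl(2)\<close>-representation a lowest weight vector has nonpositive weight.  Here \<open>B\<close> raises, \<open>A\<close>
  lowers, and \<open>v\<close> has the weight of \<open>B\<close> itself.  The condition \<open>B (A v) = 0\<close> replaces \<open>A v = 0\<close>,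
  so that \<open>v\<close> need only be of lowest weight modulo vectors killed by \<open>B\<close>; this avoids passing to a
  quotient module.
\<close>
lemma no_positive_lowest_weight:
  fixes scale :: "'k::field_char_0 \<Rightarrow> 'a::ab_group_add \<Rightarrow> 'a"
  assumes vs: "vector_space scale"
    and fd: "\<exists>S. finite S \<and> module.span scale S = UNIV"
    and linA: "Vector_Spaces.linear scale scale A"
    and linB: "Vector_Spaces.linear scale scale B"
    and linH: "Vector_Spaces.linear scale scale H"
    and AB: "\<And>x. A (B x) - B (A x) = scale c (H x)"
    and HB: "\<And>x. H (B x) - B (H x) = scale l (B x)"
    and Hv: "H v = scale l v"
    and BAv: "B (A v) = 0"
    and v: "v \<noteq> 0" and l: "l \<noteq> 0"
  shows "c = 0"
proof (rule ccontr)
  assume c: "c \<noteq> 0"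
  interpret vector_space scale by (rule vs)
  interpret A: Vector_Spaces.linear scale scale A by (rule linA)
  interpret B: Vector_Spaces.linear scale scale B by (rule linB)
  define w where "w n = (B ^^ n) v" for n
  have wSuc: "w (Suc n) = B (w n)" for n by (simp add: w_def)
  have AB': "A (B x) = B (A x) + scale c (H x)" for x
    using AB[of x] by (simp add: algebra_simps)
  have HB': "H (B x) = B (H x) + scale l (B x)" for x
    using HB[of x] by (simp add: algebra_simps)
  have Hw: "H (w n) = scale (of_nat (Suc n) * l) (w n)" for n
  proof (induction n)
    case 0
    then show ?case by (simp add: w_def Hv)
  next
    case (Suc n)
    have "H (w (Suc n)) = scale (of_nat (Suc n) * l) (w (Suc n)) + scale l (w (Suc n))"
      by (simp only: wSuc HB' Suc B.scale)
    then show ?case by (simp add: scale_left_distrib[symmetric] distrib_right add.commute)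
  qed
  have Aw: "A (w (Suc n)) = scale (c * l * of_nat (\<Sum>i\<le>Suc n. i)) (w n)" for n
  proof (induction n)
    case 0
    then show ?case by (simp add: w_def AB' BAv Hv)
  next
    case (Suc n)
    have "A (w (Suc (Suc n))) = B (A (w (Suc n))) + scale c (H (w (Suc n)))"
      by (simp only: wSuc AB')
    also have "\<dots> = scale (c * l * of_nat (\<Sum>i\<le>Suc n. i)) (w (Suc n))
                 + scale (c * l * of_nat (Suc (Suc n))) (w (Suc n))"
      by (simp only: Suc Hw B.scale wSuc[symmetric] scale_scale ac_simps)
    also have "\<dots> = scale (c * l * of_nat (\<Sum>i\<le>Suc (Suc n). i)) (w (Suc n))"
      by (simp only: scale_left_distrib[symmetric] distrib_left[symmetric]
            of_nat_add[symmetric] sum.atMost_Suc[of "\<lambda>i. i" "Suc n"])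
    finally show ?case .
  qed
  have w0: "w n \<noteq> 0" for n
  proof (induction n)
    case 0
    then show ?case using v by (simp add: w_def)
  next
    case (Suc n)
    have "(\<Sum>i\<le>Suc n. i) \<noteq> (0::nat)" by simp
    then have "c * l * of_nat (\<Sum>i\<le>Suc n. i) \<noteq> 0"
      using c l by (simp only: mult_eq_0_iff of_nat_eq_0_iff simp_thms not_False_eq_True)
    then have "A (w (Suc n)) \<noteq> 0" using Suc by (simp only: Aw scale_eq_0_iff simp_thms not_False_eq_True)
    then show ?case using A.zero by metis
  qed
  have winj: "inj w"
  proof (rule injI)
    fix m n assume "w m = w n"
    then have "scale (of_nat (Suc m) * l) (w n) = scale (of_nat (Suc n) * l) (w n)"
      using Hw by metis
    then have "of_nat (Suc m) * l = of_nat (Suc n) * l" using w0 scale_right_imp_eq by blast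
    then show "m = n" using l by (simp del: of_nat_Suc)
  qed
  obtain S where S: "finite S" "span S = UNIV" using fd by blast
  let ?E = "w ` {..card S}"
  have "independent ?E"
  proof (rule eigenvectors_independent[OF linH, where k = "\<lambda>x. of_nat (Suc (the_inv w x)) * l"])
    show "finite ?E" by simp
    show "x \<noteq> 0 \<and> H x = scale (of_nat (Suc (the_inv w x)) * l) x" if "x \<in> ?E" for x
      using that w0 Hw winj by (auto simp: the_inv_f_f simp del: of_nat_Suc)
    show "inj_on (\<lambda>x. of_nat (Suc (the_inv w x)) * l) ?E"
      using winj l by (auto simp: inj_on_def the_inv_f_f simp del: of_nat_Suc)
  qed
  then have "card ?E \<le> card S"
    using independent_span_bound[OF S(1)] S(2) by blast
  moreover have "card ?E = Suc (card S)"
    using winj by (simp add: card_image inj_on_subset)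
  ultimately show False by simp
qed

section \<open>Root spaces of dimension one\<close>

text \<open>
  Nilpotency puts \<open>h\<close> inside the zero root space, hence inside the line through \<open>e0\<close>; self-normalization
  excludes \<open>h = {0}\<close>, whose normalizer is everything.
\<close>
lemma cartan_eq_line:
  assumes lsa: "left_symmetric_algebra scale mul"
    and nz: "(UNIV :: 'a::ab_group_add set) \<noteq> {0}"
    and car: "cartan_subalgebra scale (lie_bracket mul) h"
    and dim: "vector_space.dim scale (root_subspace scale (lie_bracket mul) h (\<lambda>_. 0)) \<le> 1"
    and e0: "(e0::'a) \<in> root_subspace scale (lie_bracket mul) h (\<lambda>_. 0)" "e0 \<noteq> 0"
  shows "h = range (\<lambda>c. scale c e0)"
proof -
  interpret left_symmetric_algebra scale mul by (rule lsa)
  let ?br = "lie_bracket mul"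
  let ?R = "root_subspace scale ?br h (\<lambda>_. 0)"
  have sub: "subspace h" using car by (simp add: cartan_subalgebra_def)
  obtain N where N: "lower_central scale ?br h N = {0}"
    using car by (auto simp: cartan_subalgebra_def)
  have "h \<subseteq> ?R"
  proof
    fix y assume y: "y \<in> h"
    have "(?br x ^^ n) y \<in> lower_central scale ?br h n" if "x \<in> h" for x n
      by (induction n) (use y that in \<open>auto intro!: span_base\<close>)
    then have "(?br x ^^ N) y = 0" if "x \<in> h" for x
      using N that by blast
    then show "y \<in> ?R" unfolding root_subspace_def by (simp add: scale_zero_left) blast
  qed
  then have line: "\<exists>c. y = scale c e0" if "y \<in> h" for y
    using dim_le_1_subset_line[OF finite_dim dim e0(1) e0(2)] that by blast
  have "h \<noteq> {0}"
  proof
    assume h0: "h = {0}"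
    have "?br x 0 = 0" for x
    proof -
      interpret L: Vector_Spaces.linear scale scale "mul x" by (rule linear_left)
      interpret R: Vector_Spaces.linear scale scale "\<lambda>y. mul y x" by (rule linear_right)
      show ?thesis using L.zero R.zero by (simp add: lie_bracket_def)
    qed
    then have "{x. \<forall>y\<in>h. ?br x y \<in> h} = UNIV" by (simp add: h0)
    then show False using car nz h0 by (simp add: cartan_subalgebra_def)
  qed
  then obtain y where y: "y \<in> h" "y \<noteq> 0" using subspace_0[OF sub] by blast
  obtain c where c: "y = scale c e0" using line[OF y(1)] by blast
  then have "c \<noteq> 0" using y(2) by auto
  then have "e0 = scale (inverse c) y" by (simp add: c)
  then have "e0 \<in> h" using subspace_scale[OF sub y(1)] by metis
  then show ?thesis using line subspace_scale[OF sub] by blast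
qed

text \<open>
  The operator \<open>\<rho>(e0) - \<phi>(e0)\<close> maps the root space, a line, into itself; being nilpotent there, it
  vanishes.
\<close>
lemma root_vector_eigenvector:
  assumes vs: "vector_space scale"
    and fd: "\<exists>B. finite B \<and> module.span scale B = UNIV"
    and linl: "\<And>x. Vector_Spaces.linear scale scale (\<rho> x)"
    and linr: "\<And>x c y. \<rho> (scale c x) y = scale c (\<rho> x y)"
    and h: "h = range (\<lambda>c. scale c e0)"
    and phi: "linear_functional_on scale h \<phi>"
    and dim: "vector_space.dim scale (root_subspace scale \<rho> h \<phi>) \<le> 1"
    and v: "v \<in> root_subspace scale \<rho> h \<phi>" "v \<noteq> 0"
  shows "\<rho> e0 v = scale (\<phi> e0) v"
proof -
  interpret vector_space scale by (rule vs)
  have e0: "e0 \<in> h" using h by (auto intro!: image_eqI[where x = 1])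
  let ?T = "\<lambda>x w. \<rho> x w - scale (\<phi> x) w"
  have linT: "?T x (scale c w) = scale c (?T x w)" for x c w
  proof -
    interpret L: Vector_Spaces.linear scale scale "\<rho> x" by (rule linl)
    show ?thesis by (simp add: L.scale scale_right_diff_distrib ac_simps)
  qed
  have T: "?T (scale c e0) w = scale c (?T e0 w)" for c w
    using phi e0 by (simp add: linr linear_functional_on_def scale_right_diff_distrib)
  have "?T e0 v \<in> root_subspace scale \<rho> h \<phi>"
    unfolding root_subspace_def
  proof (intro CollectI ballI)
    fix x assume x: "x \<in> h"
    then obtain c where c: "x = scale c e0" using h by blast
    obtain n where n: "(?T e0 ^^ n) v = 0" using v(1) e0 by (auto simp: root_subspace_def)
    have pw: "(?T x ^^ m) w = scale (c ^ m) ((?T e0 ^^ m) w)" for m w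
    proof (induction m)
      case (Suc m)
      have "(?T x ^^ Suc m) w = ?T x ((?T x ^^ m) w)" by simp
      also have "\<dots> = scale c (?T e0 (scale (c ^ m) ((?T e0 ^^ m) w)))"
        unfolding Suc unfolding c by (rule T)
      also have "\<dots> = scale (c ^ Suc m) ((?T e0 ^^ Suc m) w)"
        unfolding linT by simp
      finally show ?case .
    qed simp
    have "(?T e0 ^^ n) (?T e0 v) = ?T e0 ((?T e0 ^^ n) v)"
      using funpow_swap1[of "?T e0" n v] by simp
    also have "\<dots> = 0" unfolding n using linT[of e0 0 0] by simp
    finally have "(?T x ^^ n) (?T e0 v) = 0" unfolding pw by simp
    then show "\<exists>n. (?T x ^^ n) (?T e0 v) = 0" by blast
  qed
  then obtain k where k: "?T e0 v = scale k v"
    using dim_le_1_subset_line[OF fd dim v] by blast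
  obtain n where n: "(?T e0 ^^ n) v = 0" using v(1) e0 by (auto simp: root_subspace_def)
  have "(?T e0 ^^ m) v = scale (k ^ m) v" for m
  proof (induction m)
    case (Suc m)
    have "(?T e0 ^^ Suc m) v = ?T e0 ((?T e0 ^^ m) v)" by simp
    then show ?case unfolding Suc linT k by (simp add: mult.commute)
  qed simp
  then have "k = 0" using n v(2) by simp
  then show ?thesis using k by simp
qed

section \<open>Opposite root vectors\<close>

lemma (in left_symmetric_algebra) left_representation:
  "mul x (mul y z) - mul y (mul x z) = mul (lie_bracket mul x y) z"
proof -
  interpret R: Vector_Spaces.linear scale scale "\<lambda>x. mul x z" by (rule linear_right)
  show ?thesis using left_symmetric[of x y z]
    by (simp add: lie_bracket_def R.diff algebra_simps)
qed

text \<open>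
  The instance of \<open>no_positive_lowest_weight\<close> with \<open>A = L(a)\<close>, \<open>B = L(b)\<close>, \<open>H = L(e0)\<close> and \<open>v = b\<close>:
  since \<open>a b\<close> is a multiple of \<open>e0\<close>, which \<open>b\<close> kills, the vector \<open>b\<close> qualifies.
\<close>
lemma opposite_root_vectors_commute:
  fixes scale :: "'k::field_char_0 \<Rightarrow> 'a::ab_group_add \<Rightarrow> 'a"
  assumes lsa: "left_symmetric_algebra scale mul"
    and ab: "mul a b = scale \<alpha> e0" and ba: "mul b a = scale \<beta> e0"
    and Hb: "mul e0 b = scale l b" and bH: "mul b e0 = 0"
    and "l \<noteq> 0" "b \<noteq> 0"
  shows "mul a b = mul b a"
proof -
  interpret left_symmetric_algebra scale mul by (rule lsa)
  have scale_left: "mul (scale k x) y = scale k (mul x y)" for k x y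
  proof -
    interpret R: Vector_Spaces.linear scale scale "\<lambda>x. mul x y" by (rule linear_right)
    show ?thesis by (rule R.scale)
  qed
  interpret L: Vector_Spaces.linear scale scale "mul b" by (rule linear_left)
  have "\<alpha> - \<beta> = 0"
  proof (rule no_positive_lowest_weight[OF vector_space_axioms finite_dim linear_left
        linear_left linear_left])
    show "mul a (mul b x) - mul b (mul a x) = scale (\<alpha> - \<beta>) (mul e0 x)" for x
      unfolding left_representation
      by (simp add: lie_bracket_def ab ba scale_left_diff_distrib[symmetric] scale_left)
    show "mul e0 (mul b x) - mul b (mul e0 x) = scale l (mul b x)" for x
      unfolding left_representation by (simp add: lie_bracket_def Hb bH scale_left)
    show "mul e0 b = scale l b" by (rule Hb)
    show "mul b (mul a b) = 0" by (simp add: ab L.scale bH)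
  qed fact+
  then show ?thesis by (simp add: ab ba)
qed

section \<open>Edges into the zero root\<close>

theorem mainTheorem5:
  fixes scale :: "complex \<Rightarrow> 'a::ab_group_add \<Rightarrow> 'a"
    and mul :: "'a \<Rightarrow> 'a \<Rightarrow> 'a"
    and h :: "'a set"
    and e0 :: 'a
    and e :: "complex \<Rightarrow> 'a"
    and l :: complex
  defines "\<Gamma> \<equiv> left_graph scale mul (spectrum scale mul h e0) e"
  assumes "left_symmetric_algebra scale mul"
    and "(UNIV :: 'a set) \<noteq> {0}"
    and "complete_lsa scale mul"
    and "canonical_cartan scale mul h"
    and "\<And>\<phi>. linear_functional_on scale h \<phi> \<Longrightarrow>
           vector_space.dim scale (root_subspace scale mul h \<phi>) \<le> 1"
    and "e0 \<in> root_subspace scale mul h (\<lambda>_. 0)" and "e0 \<noteq> 0"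
    and "root_base scale mul h e0 e"
    and "(l, 0) \<in> parcs \<Gamma>"
  shows "- l \<in> pverts \<Gamma> \<and> (- l, 0) \<in> parcs \<Gamma>"
proof -
  interpret left_symmetric_algebra scale mul by fact
  note dim = assms(6) and e0 = assms(7,8) and base = assms(9)
  let ?S = "spectrum scale mul h e0"
  let ?br = "lie_bracket mul"
  have lin0: "linear_functional_on scale h (\<lambda>_. 0)" by (simp add: linear_functional_on_def)
  have eqR: "root_subspace scale mul h \<phi> = root_subspace scale ?br h \<phi>"
    if "linear_functional_on scale h \<phi>" for \<phi>
    using that assms(5) by (simp add: canonical_cartan_def)
  have h: "h = range (\<lambda>c. scale c e0)"
    using cartan_eq_line[OF assms(2,3), of h e0] assms(5) dim[OF lin0] e0 eqR[OF lin0]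
    by (simp add: canonical_cartan_def)
  have scale_left: "mul (scale k x) y = scale k (mul x y)" for k x y
  proof -
    interpret R: Vector_Spaces.linear scale scale "\<lambda>x. mul x y" by (rule linear_right)
    show ?thesis by (rule R.scale)
  qed
  have scale_right: "mul x (scale k y) = scale k (mul x y)" for k x y
  proof -
    interpret L: Vector_Spaces.linear scale scale "mul x" by (rule linear_left)
    show ?thesis by (rule L.scale)
  qed
  have br_lin: "Vector_Spaces.linear scale scale (?br x)" for x
  proof -
    interpret pair: vector_space_pair scale scale by unfold_locales
    show ?thesis
      unfolding lie_bracket_def
      by (rule pair.linear_compose_sub[OF linear_left linear_right])
  qed
  have br_scale: "?br (scale c x) y = scale c (?br x y)" for c x y
    by (simp add: lie_bracket_def scale_left scale_right scale_right_diff_distrib)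
  have root: "mul e0 (e \<mu>) = scale \<mu> (e \<mu>) \<and> ?br e0 (e \<mu>) = scale \<mu> (e \<mu>) \<and> e \<mu> \<noteq> 0"
    if \<mu>: "\<mu> \<in> ?S" for \<mu>
  proof -
    obtain \<phi> where \<phi>: "\<mu> = \<phi> e0" "linear_functional_on scale h \<phi>"
      "root_subspace scale mul h \<phi> \<noteq> {0}"
      using \<mu> unfolding spectrum_def by blast
    have e: "e \<mu> \<in> root_subspace scale mul h \<phi>" "e \<mu> \<noteq> 0" "mul e0 (e \<mu>) = scale \<mu> (e \<mu>)"
      using base \<phi> by (auto simp: root_base_def)
    have "?br e0 (e \<mu>) = scale (\<phi> e0) (e \<mu>)"
      using root_vector_eigenvector[OF vector_space_axioms finite_dim br_lin br_scale h \<phi>(2)]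
        dim[OF \<phi>(2)] e(1,2) eqR[OF \<phi>(2)] by simp
    then show ?thesis using e \<phi>(1) by simp
  qed
  have kill: "mul (e \<mu>) e0 = 0" if "\<mu> \<in> ?S" for \<mu>
  proof (rule diff_left_imp_eq)
    show "mul e0 (e \<mu>) - mul (e \<mu>) e0 = mul e0 (e \<mu>) - 0"
      using root[OF that] unfolding lie_bracket_def by (metis diff_zero)
  qed
  have zero: "\<exists>c. w = scale c e0" if w: "mul e0 w = 0" for w
  proof -
    have "w \<in> root_subspace scale mul h (\<lambda>_. 0)"
      unfolding root_subspace_def h
      by (auto simp: scale_left w intro!: exI[where x = 1])
    then show ?thesis using dim_le_1_subset_line[OF finite_dim dim[OF lin0] e0] by blast
  qed
  have l: "l \<in> ?S" "0 \<in> ?S" "structure_const scale mul ?S e (- l) l \<noteq> 0"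
    using assms(10) by (auto simp: \<Gamma>_def left_graph_def)
  have ml: "- l \<in> ?S"
  proof (rule ccontr)
    assume "- l \<notin> ?S"
    then have "e (- l) = 0" using base by (auto simp: root_base_def)
    then have "mul (e (- l)) (e l) = 0" using scale_left[of 0 0 "e l"] by simp
    then show False using l(3) by (simp add: structure_const_def representation_zero)
  qed
  \<comment> \<open>The weights add up to \<open>0\<close> in such a product, because \<open>ad e0\<close> and \<open>L(e0)\<close>
    agree on root vectors.\<close>
  have prod: "\<exists>c. mul (e \<mu>) (e (- \<mu>)) = scale c e0" if "\<mu> \<in> ?S" "- \<mu> \<in> ?S" for \<mu>
  proof (rule zero)
    have "mul e0 (mul (e \<mu>) (e (- \<mu>))) - mul (e \<mu>) (mul e0 (e (- \<mu>)))
        = mul (?br e0 (e \<mu>)) (e (- \<mu>))"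
      by (rule left_representation)
    then have "mul e0 (mul (e \<mu>) (e (- \<mu>))) - scale (- \<mu>) (mul (e \<mu>) (e (- \<mu>)))
        = scale \<mu> (mul (e \<mu>) (e (- \<mu>)))"
      using root[OF that(1)] root[OF that(2)] by (metis scale_left scale_right)
    then show "mul e0 (mul (e \<mu>) (e (- \<mu>))) = 0" by simp
  qed
  have "mul (e (- l)) (e l) = mul (e l) (e (- l))"
  proof (cases "l = 0")
    case False
    obtain \<alpha> \<beta> where "mul (e (- l)) (e l) = scale \<alpha> e0" "mul (e l) (e (- l)) = scale \<beta> e0"
      using prod[of l] prod[of "- l"] l(1) ml by auto
    then show ?thesis
      using opposite_root_vectors_commute[OF assms(2) _ _ _ kill[OF l(1)] False] root[OF l(1)]
      by blast
  qed simp
  then have "structure_const scale mul ?S e l (- l) \<noteq> 0"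
    using l(3) by (simp add: structure_const_def)
  then show ?thesis using ml l(2) by (simp add: \<Gamma>_def left_graph_def)
qed

end
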